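(* Let $(X(t),\dot X(t))$, $X(t)=\{x_j(t)\}_{j=1}^J$, be a global solution (on $[0,\infty)$) of the linear second-order EKI system $$\ddot x_j+\gamma\dot x_j=-\beta C(X)(Ax_j-b)+k\sum_{i\neq j}f(\|x_i-x_j\|)(x_j-x_i)-\alpha(x_j-\bar x),\qquad j=1,\dots,J,$$ such that $(X(t),\dot X(t))\to(X_\infty,0)$ as $t\to\infty$, with $X_\infty=\{x_j^\infty\}_{j=1}^J$. Let $\bar x_\infty:=\frac1J\sum_{j=1}^Jx_j^\infty$, $C_\infty:=C(X_\infty)$, and $\mathcal V_\infty:=\operatorname{Range}(C_\infty)$. Then $$C_\infty(A\bar x_\infty-b)=0,$$ i.e. $\bar x_\infty$ is a stationary point of $\Phi$ restricted to the affine space $\mathcal A_\infty:=\bar x_\infty+\mathcal V_\infty$. If, in addition, $A$ is positive definite on $\mathcal V_\infty$, then $\bar x_\infty$ is the unique minimizer of $\Phi$ on $\mathcal A_\infty$.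
   Context: Here $x_j(t)\in\mathbb R^d$, $\bar x=\frac1J\sum_jx_j$, $C(X)=\frac1J\sum_{j=1}^J(x_j-\bar x)(x_j-\bar x)^T$ is the empirical covariance; $G\in\mathbb R^{K\times d}$ is a matrix, $\Gamma\in\mathbb R^{K\times K}$ is symmetric positive definite, $y\in\mathbb R^K$, $A:=G^T\Gamma^{-1}G$, $b:=G^T\Gamma^{-1}y$. The least-squares functional is $\Phi(x)=\frac12(y-Gx)^T\Gamma^{-1}(y-Gx)$, so that $\nabla\Phi(x)=Ax-b$. Parameters: $\gamma>0$, $\beta>0$, $k\ge0$, $\alpha\ge0$. The interaction kernel $f:[0,\infty)\to(0,\infty)$ is smooth and non-increasing. $\|\cdot\|$ is the Euclidean norm. Stationary point of $\Phi$ restricted to $\mathcal A_\infty$ means $\nabla\Phi(\bar x_\infty)\perp\mathcal V_\infty$. "$A$ is positive definite on $\mathcal V_\infty$" means $v^TAv>0$ for all nonzero $v\in\mathcal V_\infty$. *)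

theory Defs
  imports "HOL-Analysis.Analysis"
begin

text \<open>
  An ensemble of $J$ particles in $\mathbb{R}^d$ is a vector of type
  \<^typ>\<open>(real^'d)^'j\<close>, with $J = $ \<^term>\<open>CARD('j)\<close>.
\<close>

definition ensemble_mean :: "(real^'d)^'j \<Rightarrow> real^'d" where
  "ensemble_mean X = (1 / real CARD('j)) *\<^sub>R (\<Sum>j\<in>UNIV. X $ j)"

definition outer :: "real^'n \<Rightarrow> real^'m \<Rightarrow> real^'m^'n" where
  "outer u v = (\<chi> i j. u $ i * v $ j)"

definition empirical_cov :: "(real^'d)^'j \<Rightarrow> real^'d^'d" where
  "empirical_cov X = (1 / real CARD('j)) *\<^sub>R
     (\<Sum>j\<in>UNIV. outer (X $ j - ensemble_mean X) (X $ j - ensemble_mean X))"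

definition pos_def_on :: "real^'n^'n \<Rightarrow> (real^'n) set \<Rightarrow> bool" where
  "pos_def_on M V \<longleftrightarrow> (\<forall>v\<in>V. v \<noteq> 0 \<longrightarrow> 0 < v \<bullet> (M *v v))"

definition sym_pos_def :: "real^'n^'n \<Rightarrow> bool" where
  "sym_pos_def M \<longleftrightarrow> transpose M = M \<and> pos_def_on M UNIV"

definition eki_A :: "real^'d^'k \<Rightarrow> real^'k^'k \<Rightarrow> real^'d^'d" where
  "eki_A G \<Gamma> = transpose G ** matrix_inv \<Gamma> ** G"

definition eki_b :: "real^'d^'k \<Rightarrow> real^'k^'k \<Rightarrow> real^'k \<Rightarrow> real^'d" where
  "eki_b G \<Gamma> y = (transpose G ** matrix_inv \<Gamma>) *v y"

definition least_squares :: "real^'d^'k \<Rightarrow> real^'k^'k \<Rightarrow> real^'k \<Rightarrow> real^'d \<Rightarrow> real" where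
  "least_squares G \<Gamma> y x = (1/2) * ((y - G *v x) \<bullet> (matrix_inv \<Gamma> *v (y - G *v x)))"

text \<open>
  Smoothness on the closed half-line: derivatives of all orders exist on $[0,\infty)$, one-sided
  at $0$. The values of \<^term>\<open>f\<close> at negative arguments are irrelevant.
\<close>

definition smooth_halfline :: "(real \<Rightarrow> real) \<Rightarrow> bool" where
  "smooth_halfline f \<longleftrightarrow>
     (\<exists>D :: nat \<Rightarrow> real \<Rightarrow> real. D 0 = f \<and>
        (\<forall>n. \<forall>r\<ge>0. (D n has_real_derivative D (Suc n) r) (at r within {0..})))"

definition interaction_kernel :: "(real \<Rightarrow> real) \<Rightarrow> bool" where
  "interaction_kernel f \<longleftrightarrow>
     smooth_halfline f \<and> (\<forall>r\<ge>0. 0 < f r) \<and> antimono_on {0..} f"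

definition eki_acceleration ::
  "real \<Rightarrow> real \<Rightarrow> real \<Rightarrow> real \<Rightarrow> (real \<Rightarrow> real) \<Rightarrow> real^'d^'d \<Rightarrow> real^'d \<Rightarrow>
   (real^'d)^'j \<Rightarrow> (real^'d)^'j \<Rightarrow> (real^'d)^'j" where
  "eki_acceleration \<gamma> \<beta> k \<alpha> f A b X V =
     (\<chi> j. - \<gamma> *\<^sub>R (V $ j)
           - \<beta> *\<^sub>R (empirical_cov X *v (A *v (X $ j) - b))
           + k *\<^sub>R (\<Sum>i\<in>UNIV - {j}. f (norm (X $ i - X $ j)) *\<^sub>R (X $ j - X $ i))
           - \<alpha> *\<^sub>R (X $ j - ensemble_mean X))"

text \<open>The function \<^term>\<open>V\<close> is the velocity of \<^term>\<open>X\<close>; derivatives at time $0$ are one-sided.\<close>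

definition eki_global_solution ::
  "real \<Rightarrow> real \<Rightarrow> real \<Rightarrow> real \<Rightarrow> (real \<Rightarrow> real) \<Rightarrow> real^'d^'d \<Rightarrow> real^'d \<Rightarrow>
   (real \<Rightarrow> (real^'d)^'j) \<Rightarrow> (real \<Rightarrow> (real^'d)^'j) \<Rightarrow> bool" where
  "eki_global_solution \<gamma> \<beta> k \<alpha> f A b X V \<longleftrightarrow>
     (\<forall>t\<ge>0.
        (X has_vector_derivative V t) (at t within {0..}) \<and>
        (V has_vector_derivative eki_acceleration \<gamma> \<beta> k \<alpha> f A b (X t) (V t)) (at t within {0..}))"

text \<open>
  Stationarity at \<^term>\<open>x\<close> of the restriction of \<^term>\<open>\<phi>\<close> to the affine space through
  \<^term>\<open>x\<close> with direction space \<^term>\<open>V\<close>.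
\<close>

definition stationary_along :: "('a::real_inner \<Rightarrow> real) \<Rightarrow> 'a set \<Rightarrow> 'a \<Rightarrow> bool" where
  "stationary_along \<phi> V x \<longleftrightarrow> (\<exists>g. GDERIV \<phi> x :> g \<and> (\<forall>v\<in>V. orthogonal g v))"

end

theory Submission
  imports Defs
begin

text \<open>
  Averaging the equations over the particles cancels the interaction forces (by antisymmetry) and
  the confinement term, so the mean velocity \<open>w\<close> satisfies
  \<open>w' = - \<gamma> w - \<beta> C(X) (A x - b)\<close>, with \<open>x\<close> the ensemble mean. The right-hand side converges to
  \<open>- \<beta> C\<^sub>\<infinity> (A x\<^sub>\<infinity> - b)\<close> while \<open>w\<close> tends to zero, and the derivative of a convergent function can only
  converge to zero. The statements about \<open>\<Phi>\<close> follow from the symmetry of \<open>C\<^sub>\<infinity>\<close> and the exact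
  second-order expansion of \<open>\<Phi>\<close>.
\<close>

text \<open>If \<open>c\<close> were nonzero, the scalar component of \<open>w\<close> along
  \<open>c\<close> would eventually have slope above \<open>c \<bullet> c / 2\<close>, so its
  increments over intervals of length one could not tend to zero. Pairing with \<open>c\<close>
  makes the scalar mean value theorem applicable.\<close>

lemma limit_of_derivative_zero:
  fixes w w' :: "real \<Rightarrow> 'a::real_inner"
  assumes deriv: "\<And>t. t \<ge> 0 \<Longrightarrow> (w has_vector_derivative w' t) (at t within {0..})"
    and w: "(w \<longlongrightarrow> l) at_top" and w': "(w' \<longlongrightarrow> c) at_top"
  shows "c = 0"
proof (rule ccontr)
  assume "c \<noteq> 0"
  define g where "g t = w t \<bullet> c" for t
  define g' where "g' t = w' t \<bullet> c" for t
  have "(g' \<longlongrightarrow> c \<bullet> c) at_top"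
    unfolding g'_def by (intro tendsto_intros w')
  moreover have "c \<bullet> c / 2 < c \<bullet> c"
    using \<open>c \<noteq> 0\<close> by simp
  ultimately have "\<forall>\<^sub>F t in at_top. c \<bullet> c / 2 < g' t"
    by (rule order_tendstoD)
  then obtain T where T: "\<And>t. t \<ge> T \<Longrightarrow> c \<bullet> c / 2 < g' t"
    by (auto simp: eventually_at_top_linorder)
  have "((\<lambda>t. w (t + 1)) \<longlongrightarrow> l) at_top"
    using filterlim_tendsto_add_at_top[OF tendsto_const filterlim_ident, of 1]
    by (intro filterlim_compose[OF w]) (simp add: add.commute)
  then have "((\<lambda>t. g (t + 1) - g t) \<longlongrightarrow> l \<bullet> c - l \<bullet> c) at_top"
    unfolding g_def by (intro tendsto_intros w)
  moreover have "l \<bullet> c - l \<bullet> c < c \<bullet> c / 2"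
    using \<open>c \<noteq> 0\<close> by simp
  ultimately have "\<forall>\<^sub>F t in at_top. g (t + 1) - g t < c \<bullet> c / 2"
    by (rule order_tendstoD)
  \<comment> \<open>The bound 0 keeps the interval from \<open>t\<close> to \<open>t + 1\<close>
    inside the half-line where \<open>deriv\<close> applies; the bound \<open>T\<close> makes the
    slope estimate valid on all of it.\<close>
  then have "\<forall>\<^sub>F t in at_top. g (t + 1) - g t < c \<bullet> c / 2 \<and> max 0 T \<le> t"
    using eventually_ge_at_top by (rule eventually_conj)
  then obtain t where t: "g (t + 1) - g t < c \<bullet> c / 2" "0 \<le> t" "T \<le> t"
    by (metis (no_types, lifting) eventually_happens' max.bounded_iff trivial_limit_at_top_linorder)
  have "(g has_derivative (\<lambda>h. g' s * h)) (at s within {t..t + 1})" if "t \<le> s" "s \<le> t + 1" for s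
  proof -
    have "(w has_derivative (\<lambda>h. h *\<^sub>R w' s)) (at s within {t..t + 1})"
      using has_derivative_subset[OF deriv[of s, unfolded has_vector_derivative_def], of "{t..t + 1}"]
        t that by auto
    from has_derivative_inner_left[OF this, of c] show ?thesis
      by (simp add: g_def[abs_def] g'_def mult.commute)
  qed
  from mvt_simple[of t "t + 1" g "\<lambda>s h. g' s * h", OF _ this]
  obtain s where "s \<in> {t<..<t + 1}" "g (t + 1) - g t = g' s"
    by auto
  with T[of s] t show False
    by auto
qed

lemma linear_ensemble_mean: "linear ensemble_mean"
  by (rule linearI)
    (simp_all add: ensemble_mean_def sum.distrib scaleR_sum_right scaleR_add_right mult.commute)

lemma bounded_linear_ensemble_mean: "bounded_linear ensemble_mean"
  using linear_ensemble_mean by (simp only: linear_conv_bounded_linear)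

lemma transpose_empirical_cov: "transpose (empirical_cov X) = empirical_cov X"
  by (simp add: vec_eq_iff transpose_def empirical_cov_def outer_def mult.commute)

lemma tendsto_empirical_cov:
  assumes "(X \<longlongrightarrow> L) F"
  shows "((\<lambda>t. empirical_cov (X t)) \<longlongrightarrow> empirical_cov L) F"
  unfolding empirical_cov_def outer_def
  by (intro tendsto_intros assms tendsto_vec_lambda bounded_linear.tendsto[OF bounded_linear_ensemble_mean])

lemma tendsto_matrix_vector_mult:
  fixes M :: "'a \<Rightarrow> real^'n^'m"
  assumes "(M \<longlongrightarrow> N) F" "(x \<longlongrightarrow> z) F"
  shows "((\<lambda>t. M t *v x t) \<longlongrightarrow> N *v z) F"
  unfolding matrix_vector_mult_def by (intro tendsto_intros tendsto_vec_lambda assms)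

text \<open>The force of \<open>i\<close> on \<open>j\<close> is opposite to that of
  \<open>j\<close> on \<open>i\<close>, so exchanging the two indices shows that the double sum
  equals its own negative.\<close>

lemma sum_interaction_zero:
  fixes X :: "(real^'d)^'j"
  shows "(\<Sum>j\<in>UNIV. \<Sum>i\<in>UNIV - {j}. f (norm (X $ i - X $ j)) *\<^sub>R (X $ j - X $ i)) = 0"
proof -
  let ?h = "\<lambda>j i. f (norm (X $ i - X $ j)) *\<^sub>R (X $ j - X $ i)"
  have anti: "?h i j = - ?h j i" for i j
    by (simp add: norm_minus_commute flip: scaleR_minus_right)
  \<comment> \<open>The diagonal term is zero, so including it makes the index set symmetric under
    the exchange.\<close>
  have "(\<Sum>i\<in>UNIV - {j}. ?h j i) = (\<Sum>i\<in>UNIV. ?h j i)" for j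
    by (simp add: sum.remove[of UNIV j])
  then have eq: "(\<Sum>j\<in>UNIV. \<Sum>i\<in>UNIV - {j}. ?h j i) = (\<Sum>j\<in>UNIV. \<Sum>i\<in>UNIV. ?h j i)"
    by simp
  have "(\<Sum>j\<in>UNIV. \<Sum>i\<in>UNIV. ?h j i) = (\<Sum>j\<in>UNIV. \<Sum>i\<in>UNIV. ?h i j)"
    by (rule sum.swap)
  also have "\<dots> = - (\<Sum>j\<in>UNIV. \<Sum>i\<in>UNIV. ?h j i)"
    by (subst anti) (simp only: sum_negf)
  finally show ?thesis
    unfolding eq by (simp add: eq_neg_iff_add_eq_0 flip: scaleR_2)
qed

lemma sum_deviation_zero:
  fixes X :: "(real^'d)^'j"
  shows "(\<Sum>j\<in>UNIV. X $ j - ensemble_mean X) = 0"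
  by (simp add: sum_subtractf ensemble_mean_def sum_constant_scaleR del: sum_constant)

text \<open>The matrix \<open>empirical_cov X\<close> is common to all particles and the drift is
  affine in the position, so averaging the drift only replaces each position by the mean.\<close>

lemma ensemble_mean_eki_acceleration:
  fixes X V :: "(real^'d)^'j"
  shows "ensemble_mean (eki_acceleration \<gamma> \<beta> k \<alpha> f A b X V) =
    - \<gamma> *\<^sub>R ensemble_mean V - \<beta> *\<^sub>R (empirical_cov X *v (A *v ensemble_mean X - b))"
proof -
  let ?n = "real CARD('j)" and ?C = "empirical_cov X"
  have sums: "(\<Sum>j\<in>UNIV. Y $ j) = ?n *\<^sub>R ensemble_mean Y" for Y :: "(real^'d)^'j"
    by (simp add: ensemble_mean_def)
  have "(\<Sum>j\<in>UNIV. ?C *v (A *v X $ j - b)) = ?C *v (A *v (\<Sum>j\<in>UNIV. X $ j) - ?n *\<^sub>R b)"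
    by (simp add: matrix_vector_mult_diff_distrib sum_subtractf sum_constant_scaleR
        linear_sum[OF matrix_vector_mul_linear] linear_cmul[OF matrix_vector_mul_linear]
        del: sum_constant)
  also have "\<dots> = ?n *\<^sub>R (?C *v (A *v ensemble_mean X - b))"
    by (simp only: sums matrix_vector_mult_scaleR flip: scaleR_diff_right)
  finally have drift: "(\<Sum>j\<in>UNIV. ?C *v (A *v X $ j - b)) = ?n *\<^sub>R (?C *v (A *v ensemble_mean X - b))" .
  have "(\<Sum>j\<in>UNIV. eki_acceleration \<gamma> \<beta> k \<alpha> f A b X V $ j) =
      - \<gamma> *\<^sub>R (?n *\<^sub>R ensemble_mean V) - \<beta> *\<^sub>R (?n *\<^sub>R (?C *v (A *v ensemble_mean X - b)))"
    unfolding eki_acceleration_def vec_lambda_beta sum.distrib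
      sum_subtractf[of _ "\<lambda>j. \<alpha> *\<^sub>R (X $ j - ensemble_mean X)"]
      sum_subtractf[of _ "\<lambda>j. \<beta> *\<^sub>R (?C *v (A *v X $ j - b))"]
    by (simp only: drift sums sum_interaction_zero sum_deviation_zero
        scaleR_zero_right add_0_right diff_zero flip: scaleR_sum_right)
  then show ?thesis
    by (simp add: ensemble_mean_def[of "eki_acceleration \<gamma> \<beta> k \<alpha> f A b X V"] scaleR_diff_right
        scaleR_left_commute)
qed

lemma sym_pos_def_invertible:
  assumes "sym_pos_def M"
  shows "invertible M"
proof -
  have "x = 0" if "M *v x = 0" for x
    using assms that by (force simp: sym_pos_def_def pos_def_on_def)
  then show ?thesis
    by (simp add: invertible_left_inverse matrix_left_invertible_ker)
qed

text \<open>\<open>matrix_inv\<close> is a Hilbert choice, so its defining property has to be drawn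
  from the existence of an inverse.\<close>

lemma matrix_mul_matrix_inv:
  assumes "invertible M"
  shows "M ** matrix_inv M = mat 1"
  using someI_ex[OF assms[unfolded invertible_def]] by (simp add: matrix_inv_def)

text \<open>Transposing \<open>M ** matrix_inv M = mat 1\<close> turns the transposed inverse into a
  left inverse of \<open>M\<close>, and a left inverse coincides with a right inverse.\<close>

lemma transpose_matrix_inv:
  fixes M :: "real^'n^'n"
  assumes "invertible M" "transpose M = M"
  shows "transpose (matrix_inv M) = matrix_inv M"
proof -
  have "transpose (matrix_inv M) ** M = mat 1"
    by (metis assms matrix_mul_matrix_inv matrix_transpose_mul transpose_mat)
  then show ?thesis
    by (metis assms(1) matrix_mul_matrix_inv matrix_mul_assoc matrix_mul_lid matrix_mul_rid)
qed

text \<open>The functional is quadratic, so there is no remainder. This one identity yields both the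
  gradient and the strict minimality.\<close>

lemma least_squares_expansion:
  assumes "sym_pos_def \<Gamma>"
  shows "least_squares G \<Gamma> y (x + v) = least_squares G \<Gamma> y x
    + (eki_A G \<Gamma> *v x - eki_b G \<Gamma> y) \<bullet> v + (1/2) * (v \<bullet> (eki_A G \<Gamma> *v v))"
proof -
  let ?P = "matrix_inv \<Gamma>"
  define r where "r = y - G *v x"
  have sym: "transpose ?P = ?P"
    using assms by (simp add: sym_pos_def_invertible transpose_matrix_inv sym_pos_def_def)
  \<comment> \<open>Symmetry of the inverse makes the two mixed terms equal; together they cancel
    the factor 1/2.\<close>
  have cross: "r \<bullet> (?P *v (G *v v)) = (G *v v) \<bullet> (?P *v r)"
    by (metis sym dot_lmul_matrix inner_commute transpose_matrix_vector)
  have grad: "eki_A G \<Gamma> *v x - eki_b G \<Gamma> y = - (transpose G *v (?P *v r))"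
    by (simp add: eki_A_def eki_b_def r_def matrix_vector_mult_diff_distrib
        flip: matrix_vector_mul_assoc)
  have adj: "(transpose G *v u) \<bullet> v = (G *v v) \<bullet> u" for u
    by (simp add: dot_lmul_matrix) (rule inner_commute)
  have "y - G *v (x + v) = r - G *v v"
    by (simp add: r_def matrix_vector_right_distrib)
  then have "least_squares G \<Gamma> y (x + v) =
      (1/2) * (r \<bullet> (?P *v r) - r \<bullet> (?P *v (G *v v)) - (G *v v) \<bullet> (?P *v r) + (G *v v) \<bullet> (?P *v (G *v v)))"
    by (simp add: least_squares_def matrix_vector_mult_diff_distrib inner_diff_left inner_diff_right)
  moreover have "v \<bullet> (eki_A G \<Gamma> *v v) = (G *v v) \<bullet> (?P *v (G *v v))"
    by (simp only: eki_A_def adj inner_commute[of v] flip: matrix_vector_mul_assoc)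
  ultimately show ?thesis
    unfolding grad cross
    by (simp add: adj least_squares_def algebra_simps flip: r_def del: transpose_matrix_vector)
qed

lemma gderiv_least_squares:
  assumes "sym_pos_def \<Gamma>"
  shows "GDERIV (least_squares G \<Gamma> y) x :> eki_A G \<Gamma> *v x - eki_b G \<Gamma> y"
proof -
  let ?g = "eki_A G \<Gamma> *v x - eki_b G \<Gamma> y"
  \<comment> \<open>The expansion recentred at \<open>x\<close>: at \<open>z = x\<close> the
    quadratic term has zero derivative, which leaves \<open>?g\<close> as the gradient.\<close>
  let ?q = "\<lambda>z. least_squares G \<Gamma> y x + ?g \<bullet> (z - x) + (1/2) * ((z - x) \<bullet> (eki_A G \<Gamma> *v (z - x)))"
  have "least_squares G \<Gamma> y = ?q"
  proof
    fix z
    show "least_squares G \<Gamma> y z = ?q z"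
      using least_squares_expansion[OF assms, of G y x "z - x"] by simp
  qed
  moreover have "(?q has_derivative (\<lambda>h. h \<bullet> ?g)) (at x)"
    by (rule derivative_eq_intros bounded_linear.has_derivative[OF matrix_vector_mul_bounded_linear]
        | simp add: inner_commute)+
  ultimately show ?thesis
    by (simp add: gderiv_def)
qed

theorem proposition3p9:
  fixes G :: "real^'d^'k" and \<Gamma> :: "real^'k^'k" and y :: "real^'k"
    and \<gamma> \<beta> k \<alpha> :: real and f :: "real \<Rightarrow> real"
    and X V :: "real \<Rightarrow> (real^'d)^'j" and X_inf :: "(real^'d)^'j"
    and A :: "real^'d^'d" and b x_inf :: "real^'d"
    and C_inf :: "real^'d^'d" and V_inf A_inf :: "(real^'d) set"
  assumes \<Gamma>: "sym_pos_def \<Gamma>"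
    and params: "\<gamma> > 0" "\<beta> > 0" "k \<ge> 0" "\<alpha> \<ge> 0"
    and kernel: "interaction_kernel f"
    and A_def: "A = eki_A G \<Gamma>"
    and b_def: "b = eki_b G \<Gamma> y"
    and solution: "eki_global_solution \<gamma> \<beta> k \<alpha> f A b X V"
    and limit: "((\<lambda>t. (X t, V t)) \<longlongrightarrow> (X_inf, 0)) at_top"
    and x_def: "x_inf = ensemble_mean X_inf"
    and C_def: "C_inf = empirical_cov X_inf"
    and V_def: "V_inf = range ((*v) C_inf)"
    and aff_def: "A_inf = (+) x_inf ` V_inf"
  shows "C_inf *v (A *v x_inf - b) = 0
    \<and> stationary_along (least_squares G \<Gamma> y) V_inf x_inf
    \<and> (pos_def_on A V_inf \<longrightarrow>
         (\<forall>z. is_arg_min (least_squares G \<Gamma> y) (\<lambda>w. w \<in> A_inf) z \<longleftrightarrow> z = x_inf))"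
proof -
  let ?w' = "\<lambda>t. ensemble_mean (eki_acceleration \<gamma> \<beta> k \<alpha> f A b (X t) (V t))"
  note mean_lim = bounded_linear.tendsto[OF bounded_linear_ensemble_mean]
  have X: "(X \<longlongrightarrow> X_inf) at_top" and V: "(V \<longlongrightarrow> 0) at_top"
    using tendsto_fst[OF limit] tendsto_snd[OF limit] by simp_all
  have "((\<lambda>t. ensemble_mean (V t)) has_vector_derivative ?w' t) (at t within {0..})" if "t \<ge> 0" for t
    using solution that
    by (intro bounded_linear.has_vector_derivative[OF bounded_linear_ensemble_mean])
      (simp add: eki_global_solution_def)
  moreover have "((\<lambda>t. ensemble_mean (V t)) \<longlongrightarrow> 0) at_top"
    using mean_lim[OF V] by (simp add: linear_0[OF linear_ensemble_mean])
  moreover have "(?w' \<longlongrightarrow> - \<gamma> *\<^sub>R ensemble_mean (0 :: (real^'d)^'j)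
      - \<beta> *\<^sub>R (C_inf *v (A *v x_inf - b))) at_top"
    unfolding ensemble_mean_eki_acceleration C_def x_def
    by (intro tendsto_intros tendsto_matrix_vector_mult tendsto_empirical_cov mean_lim X V)
  ultimately have "- \<gamma> *\<^sub>R ensemble_mean (0 :: (real^'d)^'j) - \<beta> *\<^sub>R (C_inf *v (A *v x_inf - b)) = 0"
    by (rule limit_of_derivative_zero)
  \<comment> \<open>The damping term vanishes with the limiting velocity, and
    \<open>\<beta> > 0\<close> can be divided out.\<close>
  then have stationary: "C_inf *v (A *v x_inf - b) = 0"
    using params(2) by (simp add: linear_0[OF linear_ensemble_mean])
  have orth: "(A *v x_inf - b) \<bullet> v = 0" if "v \<in> V_inf" for v
  proof -
    obtain u where "v = C_inf *v u"
      using \<open>v \<in> V_inf\<close> unfolding V_def by blast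
    \<comment> \<open>Moving \<open>C_inf\<close> to the other factor, where its symmetry lets
      \<open>stationary\<close> apply.\<close>
    then have "(A *v x_inf - b) \<bullet> v = (transpose C_inf *v (A *v x_inf - b)) \<bullet> u"
      by (simp add: dot_lmul_matrix)
    then show ?thesis
      by (simp add: C_def transpose_empirical_cov stationary[unfolded C_def])
  qed
  then have "stationary_along (least_squares G \<Gamma> y) V_inf x_inf"
    using gderiv_least_squares[OF \<Gamma>, of G y x_inf]
    unfolding stationary_along_def orthogonal_def A_def b_def by blast
  moreover have "is_arg_min (least_squares G \<Gamma> y) (\<lambda>w. w \<in> A_inf) z \<longleftrightarrow> z = x_inf"
    if pos: "pos_def_on A V_inf" for z
  proof -
    have "0 \<in> V_inf"
      unfolding V_def by (metis matrix_vector_mult_0_right rangeI)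
    then have "x_inf \<in> A_inf"
      unfolding aff_def by force
    \<comment> \<open>Along directions in \<open>V_inf\<close> the linear term of the expansion
      vanishes by \<open>orth\<close> and the quadratic term is positive. Strictness gives
      minimality and uniqueness at once.\<close>
    moreover have "least_squares G \<Gamma> y x_inf < least_squares G \<Gamma> y u"
      if "u \<in> A_inf" "u \<noteq> x_inf" for u
    proof -
      obtain v where "u = x_inf + v" "v \<in> V_inf" "v \<noteq> 0"
        using \<open>u \<in> A_inf\<close> \<open>u \<noteq> x_inf\<close> unfolding aff_def by auto
      then show ?thesis
        using pos orth[of v] least_squares_expansion[OF \<Gamma>, of G y x_inf v]
        by (simp add: pos_def_on_def flip: A_def b_def)
    qed
    ultimately show ?thesis
      unfolding is_arg_min_def by (metis less_asym less_irrefl)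
  qed
  ultimately show ?thesis
    using stationary by blast
qed

end
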